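(* Every mixed-integer Chvátal (MIC) set is MILP-representable. That is, if $f_1,\dots,f_m:\mathbb{R}^{n+q}\to\mathbb{R}$ are finitely many affine Chvátal functions and $b_1,\dots,b_m\in\mathbb{R}$, then the set $S=\{(x,z)\in\mathbb{R}^n\times\mathbb{Z}^q : f_i(x,z)\le b_i \text{ for } i=1,\dots,m\}$, viewed as a subset of $\mathbb{R}^{n+q}$, is MILP-representable.
   Context: $\mathbb{Q}_+$ denotes the nonnegative rationals, and $\lceil a\rceil$ the smallest integer no less than $a\in\mathbb{R}$. Affine Chvátal functions. An affine Chvátal function $f:\mathbb{R}^N\to\mathbb{R}$ is a function constructed from a finite rooted binary tree in which each node is either (i) a leaf, which corresponds to an affine linear function on $\mathbb{R}^N$ with rational coefficients; (ii) a node with one child, the edge to the child being labeled either by $\lceil\cdot\rceil$ or by a number in $\mathbb{Q}_+$; or (iii) a node with two children, each edge being labeled by a number in $\mathbb{Q}_+$. The function is defined recursively from the root: a tree consisting of a single leaf represents the affine linear function of that leaf; if the root has a single child whose subtree represents $g$, then $f=\lceil g\rceil$ if the edge is labeled $\lceil\cdot\rceil$, and $f=\alpha g$ if it is labeled $\alpha\in\mathbb{Q}_+$; if the root has two children whose subtrees represent $g$ and $h$, with edges labeled $\alpha,\beta\in\mathbb{Q}_+$ respectively, then $f=\alpha g+\beta h$. MIC sets. An affine Chvátal inequality is an inequality $f(x)\le b$ where $f$ is an affine Chvátal function and $b\in\mathbb{R}$. A mixed-integer Chvátal (MIC) set is a mixed-integer set described by finitely many affine Chvátal inequalities, i.e.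 a set of the form $\{(x,z)\in\mathbb{R}^n\times\mathbb{Z}^q : f_i(x,z)\le b_i \text{ for } i=1,\dots,m\}$ with affine Chvátal functions $f_i$ and $b_i\in\mathbb{R}$. MILP-representable. A set $S\subseteq\mathbb{R}^N$ is (mixed integer linear representable, or) MILP-representable if there exist rational matrices $A,B,C$ and a rational vector $d$ such that $S$ is the projection onto the $x$ coordinates of $\{(x,y,w)\in\mathbb{R}^N\times\mathbb{R}^p\times\mathbb{Z}^r : Ax+By+Cw\ge d\}$, where $p$ and $r$ are the numbers of columns of $B$ and $C$; that is, $S=\{x\in\mathbb{R}^N : \exists\, y\in\mathbb{R}^p,\ w\in\mathbb{Z}^r \text{ with } Ax+By+Cw\ge d\}$.
   Formalization: The right-hand sides b_1,…,b_m are assumed rational; for real b_i the claim fails since MILP-representability requires a rational d (e.g. {x ∈ ℝ : x ≤ √2} is not MILP-representable). *)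

theory Defs
  imports Complex_Main "Jordan_Normal_Form.Matrix"
begin

datatype chvatal_tree =
    Leaf "rat vec" rat
  | Ceil chvatal_tree
  | Scale rat chvatal_tree
  | Comb rat chvatal_tree rat chvatal_tree

text \<open>\<open>Leaf a c\<close> stands for the affine function \<open>x \<mapsto> a \<bullet> x + c\<close>. The predicate below requires
  the coefficient vectors of all leaves to have the dimension \<open>N\<close> of the ambient space and all
  numerical edge labels to be nonnegative (zero is allowed).\<close>

fun tree_wf :: "nat \<Rightarrow> chvatal_tree \<Rightarrow> bool" where
  "tree_wf N (Leaf a c) \<longleftrightarrow> a \<in> carrier_vec N"
| "tree_wf N (Ceil t) \<longleftrightarrow> tree_wf N t"
| "tree_wf N (Scale \<alpha> t) \<longleftrightarrow> 0 \<le> \<alpha> \<and> tree_wf N t"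
| "tree_wf N (Comb \<alpha> t \<beta> u) \<longleftrightarrow> 0 \<le> \<alpha> \<and> tree_wf N t \<and> 0 \<le> \<beta> \<and> tree_wf N u"

fun tree_fun :: "chvatal_tree \<Rightarrow> real vec \<Rightarrow> real" where
  "tree_fun (Leaf a c) x = map_vec of_rat a \<bullet> x + of_rat c"
| "tree_fun (Ceil t) x = of_int \<lceil>tree_fun t x\<rceil>"
| "tree_fun (Scale \<alpha> t) x = of_rat \<alpha> * tree_fun t x"
| "tree_fun (Comb \<alpha> t \<beta> u) x = of_rat \<alpha> * tree_fun t x + of_rat \<beta> * tree_fun u x"

text \<open>A function on \<open>\<real>\<^sup>N\<close> is a HOL function on \<open>real vec\<close> of which only the values on
  \<open>carrier_vec N\<close> matter.\<close>

definition affine_chvatal :: "nat \<Rightarrow> (real vec \<Rightarrow> real) \<Rightarrow> bool" where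
  "affine_chvatal N f \<longleftrightarrow> (\<exists>t. tree_wf N t \<and> (\<forall>x\<in>carrier_vec N. f x = tree_fun t x))"

text \<open>The set described by \<open>f i (x, z) \<le> b i\<close> for \<open>i < m\<close>. It is a MIC set when all \<open>f i\<close> are
  affine Chvatal functions on \<open>\<real>\<^sup>n\<^sup>+\<^sup>q\<close>. The pair \<open>(x, z)\<close> is the concatenated vector.

  The right-hand sides \<open>b i\<close> are real, but a MIC set can only be expected to be
  MILP-representable when they are rational. The set \<open>{x \<in> \<real>. x \<le> sqrt 2}\<close>
  (\<open>n = m = 1\<close>, \<open>q = 0\<close>) is not. Suppose that \<open>(sqrt 2, y, w)\<close> satisfies a rational system
  \<open>Ax + By + Cw \<ge> d\<close> with \<open>w\<close> integral, and take a \<open>\<rat>\<close>-linear map \<open>\<phi> : \<real> \<rightarrow> \<real>\<close> with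
  \<open>\<phi> 1 = 0\<close> and \<open>\<phi> (sqrt 2) = 1\<close>. A row that is tight at this point remains tight when
  \<open>\<epsilon> * \<phi> v\<close> is added to every entry \<open>v\<close> of the point, and the other rows hold for small \<open>\<epsilon> > 0\<close>. Since
  \<open>\<phi>\<close> vanishes on \<open>\<rat>\<close>, the vector \<open>w\<close> does not change, so \<open>sqrt 2 + \<epsilon>\<close> also belongs to the projection.\<close>

definition mic_set ::
  "nat \<Rightarrow> nat \<Rightarrow> nat \<Rightarrow> (nat \<Rightarrow> real vec \<Rightarrow> real) \<Rightarrow> (nat \<Rightarrow> real) \<Rightarrow> real vec set" where
  "mic_set n q m f b =
     {x @\<^sub>v map_vec of_int z | (x :: real vec) (z :: int vec).
        x \<in> carrier_vec n \<and> z \<in> carrier_vec q \<and>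
        (\<forall>i<m. f i (x @\<^sub>v map_vec of_int z) \<le> b i)}"

definition milp_representable :: "nat \<Rightarrow> real vec set \<Rightarrow> bool" where
  "milp_representable N S \<longleftrightarrow>
     (\<exists>k p r (A :: rat mat) (B :: rat mat) (C :: rat mat) (d :: rat vec).
        A \<in> carrier_mat k N \<and> B \<in> carrier_mat k p \<and> C \<in> carrier_mat k r \<and> d \<in> carrier_vec k \<and>
        S = {x \<in> carrier_vec N. \<exists>y \<in> carrier_vec p. \<exists>w :: int vec \<in> carrier_vec r.
               map_mat of_rat A *\<^sub>v x + map_mat of_rat B *\<^sub>v y
                 + map_mat of_rat C *\<^sub>v map_vec of_int w \<ge> map_vec of_rat d})"

end

theory Submission
  imports Defs
begin

text \<open>
  The right-hand sides of affine Chvatal inequalities are upper bounds, and all edge labels are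
  nonnegative, so an affine Chvatal function is monotone in the value of each of its ceiling nodes.
  Replace every node \<open>\<lceil>g\<rceil>\<close> by an integer variable \<open>w\<close> and add the constraint that the value of \<open>g\<close>,
  with its own ceilings replaced, is at most \<open>w\<close>. By monotonicity, every integer point that
  satisfies these constraints gives the root a value that is at least the true one
  (\<open>tree_fun_le_relax\<close>), and the choice \<open>w = \<lceil>g x\<rceil>\<close> attains the true value
  (\<open>relax_true_ceilings\<close>). Hence \<open>f x \<le> b\<close> holds iff the linear system in \<open>x\<close> and \<open>w\<close> has an integral
  solution \<open>w\<close> whose value at the root is at most \<open>b\<close>.

  The variables are indexed by the subtree \<open>g\<close> under the ceiling rather than by the node.
  Several trees may then share a variable without harm: the value \<open>\<lceil>g x\<rceil>\<close> is one simultaneous choice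
  that is right for every tree, so the systems of all the inequalities can be put together without
  renaming variables apart.

  The integrality of the last \<open>q\<close> coordinates is itself expressed by affine Chvatal
  inequalities, because \<open>t\<close> is an integer iff \<open>\<lceil>t\<rceil> - t \<le> 0\<close>. A MIC set is thus the solution set of
  finitely many affine Chvatal inequalities with rational right-hand sides over \<open>\<real>\<^sup>N\<close>
  (\<open>milp_representable_chvatal_system\<close>).
\<close>

section \<open>Rational affine functions of real and integer variables\<close>

text \<open>The integer variables carry names from an arbitrary finite set \<open>J\<close>. They are numbered only
  when matrices are built, in \<open>milp_representable_affine_system\<close>.\<close>

definition rational_affine :: "nat \<Rightarrow> 'j set \<Rightarrow> (real vec \<Rightarrow> ('j \<Rightarrow> int) \<Rightarrow> real) \<Rightarrow> bool" where
  "rational_affine N J g \<longleftrightarrow>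
     (\<exists>a c d. \<forall>x\<in>carrier_vec N. \<forall>w.
        g x w = (\<Sum>i<N. of_rat (a i) * x $ i) + (\<Sum>j\<in>J. of_rat (c j) * of_int (w j)) + of_rat d)"

lemma rational_affine_const: "rational_affine N J (\<lambda>x w. of_rat d)"
  unfolding rational_affine_def
  by (intro exI[of _ "\<lambda>_. 0"] exI[of _ d]) simp

lemma rational_affine_integer_var:
  assumes "finite J" "j \<in> J"
  shows "rational_affine N J (\<lambda>x w. of_int (w j))"
  unfolding rational_affine_def
proof (intro exI ballI allI)
  fix x :: "real vec" and w :: "'a \<Rightarrow> int"
  have "(\<Sum>k\<in>J. of_rat (if k = j then 1 else 0) * of_int (w k) :: real)
      = (\<Sum>k\<in>J. if k = j then of_int (w k) else 0)"
    by (intro sum.cong) auto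
  then show "of_int (w j) = (\<Sum>i<N. of_rat ((\<lambda>_. 0) i) * x $ i)
      + (\<Sum>k\<in>J. of_rat ((\<lambda>k. if k = j then 1 else 0) k) * of_int (w k)) + of_rat 0"
    using assms by simp
qed

lemma rational_affine_scalar_prod:
  assumes "a \<in> carrier_vec N"
  shows "rational_affine N J (\<lambda>x w. map_vec of_rat a \<bullet> x + of_rat d)"
  unfolding rational_affine_def
proof (intro exI ballI allI)
  fix x :: "real vec" and w :: "'a \<Rightarrow> int"
  assume "x \<in> carrier_vec N"
  then show "map_vec of_rat a \<bullet> x + of_rat d = (\<Sum>i<N. of_rat (a $ i) * x $ i)
      + (\<Sum>k\<in>J. of_rat ((\<lambda>_. 0) k) * of_int (w k)) + of_rat d"
    using assms by (simp add: scalar_prod_def atLeast0LessThan)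
qed

lemma rational_affine_comb:
  assumes "rational_affine N J g" "rational_affine N J h"
  shows "rational_affine N J (\<lambda>x w. of_rat \<alpha> * g x w + of_rat \<beta> * h x w)"
proof -
  obtain a c d where g: "\<And>x w. x \<in> carrier_vec N \<Longrightarrow>
      g x w = (\<Sum>i<N. of_rat (a i) * x $ i) + (\<Sum>j\<in>J. of_rat (c j) * of_int (w j)) + of_rat d"
    using assms(1) unfolding rational_affine_def by blast
  obtain a' c' d' where h: "\<And>x w. x \<in> carrier_vec N \<Longrightarrow>
      h x w = (\<Sum>i<N. of_rat (a' i) * x $ i) + (\<Sum>j\<in>J. of_rat (c' j) * of_int (w j)) + of_rat d'"
    using assms(2) unfolding rational_affine_def by blast
  show ?thesis
    unfolding rational_affine_def
    by (intro exI[of _ "\<lambda>i. \<alpha> * a i + \<beta> * a' i"] exI[of _ "\<lambda>j. \<alpha> * c j + \<beta> * c' j"]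
        exI[of _ "\<alpha> * d + \<beta> * d'"])
      (simp add: g h of_rat_add of_rat_mult sum_distrib_left sum.distrib algebra_simps)
qed

lemma rational_affine_diff:
  assumes "rational_affine N J g" "rational_affine N J h"
  shows "rational_affine N J (\<lambda>x w. g x w - h x w)"
  using rational_affine_comb[OF assms, of 1 "-1"] by (simp add: of_rat_minus)

text \<open>The rows of the matrices are the functions in \<open>R\<close>, with the sign changed to turn \<open>g \<le> 0\<close> into
  a lower bound. Apart from \<open>x\<close> no real variables occur, so the matrix \<open>B\<close> has no columns.\<close>

lemma milp_representable_affine_system:
  fixes R :: "(real vec \<Rightarrow> ('j \<Rightarrow> int) \<Rightarrow> real) set"
  assumes "finite R" "finite J" and aff: "\<And>g. g \<in> R \<Longrightarrow> rational_affine N J g"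
  shows "milp_representable N {x \<in> carrier_vec N. \<exists>w. \<forall>g\<in>R. g x w \<le> 0}"
proof -
  obtain \<rho> where \<rho>: "bij_betw \<rho> {0..<card R} R"
    using ex_bij_betw_nat_finite[OF \<open>finite R\<close>] by blast
  obtain \<sigma> where \<sigma>: "bij_betw \<sigma> {0..<card J} J"
    using ex_bij_betw_nat_finite[OF \<open>finite J\<close>] by blast
  define k r where "k = card R" and "r = card J"
  have "\<forall>g\<in>R. \<exists>a c d. \<forall>x\<in>carrier_vec N. \<forall>w.
      g x w = (\<Sum>i<N. of_rat (a i) * x $ i) + (\<Sum>j\<in>J. of_rat (c j) * of_int (w j)) + of_rat d"
    using aff unfolding rational_affine_def by blast
  then obtain a c d where g: "\<And>g x w. g \<in> R \<Longrightarrow> x \<in> carrier_vec N \<Longrightarrow>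
      g x w = (\<Sum>i<N. of_rat (a g i) * x $ i) + (\<Sum>j\<in>J. of_rat (c g j) * of_int (w j)) + of_rat (d g)"
    by metis
  define A where "A = mat k N (\<lambda>(l, i). - a (\<rho> l) i)"
  define B :: "rat mat" where "B = mat k 0 (\<lambda>_. 0)"
  define C where "C = mat k r (\<lambda>(l, j). - c (\<rho> l) (\<sigma> j))"
  define e where "e = vec k (\<lambda>l. d (\<rho> l))"
  have row: "(map_mat of_rat A *\<^sub>v x + map_mat of_rat B *\<^sub>v y
        + map_mat of_rat C *\<^sub>v map_vec of_int (vec r (\<lambda>j. w (\<sigma> j)))) $ l
      = of_rat (e $ l) - \<rho> l x w"
    if "x \<in> carrier_vec N" "y \<in> carrier_vec 0" "l < k" for x y :: "real vec" and w l
  proof -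
    have "\<rho> l \<in> R"
      using \<rho> \<open>l < k\<close> unfolding k_def by (auto simp: bij_betw_def)
    moreover have "(\<Sum>j\<in>J. of_rat (c (\<rho> l) j) * of_int (w j) :: real)
        = (\<Sum>j<r. of_rat (c (\<rho> l) (\<sigma> j)) * of_int (w (\<sigma> j)))"
      using sum.reindex_bij_betw[OF \<sigma>, of "\<lambda>j. of_rat (c (\<rho> l) j) * of_int (w j) :: real"]
      by (simp add: r_def atLeast0LessThan)
    ultimately show ?thesis
      using that
      by (simp add: g A_def B_def C_def e_def scalar_prod_def atLeast0LessThan of_rat_minus
          sum_negf)
  qed
  have sys: "(map_mat of_rat A *\<^sub>v x + map_mat of_rat B *\<^sub>v y
        + map_mat of_rat C *\<^sub>v map_vec of_int (vec r (\<lambda>j. w (\<sigma> j))) \<ge> map_vec of_rat e)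
      \<longleftrightarrow> (\<forall>g\<in>R. g x w \<le> 0)"
    if x: "x \<in> carrier_vec N" and y: "y \<in> carrier_vec 0" for x y :: "real vec" and w
  proof -
    have dims: "dim_vec e = k" "dim_row A = k" "dim_row B = k" "dim_row C = k"
      by (simp_all add: A_def B_def C_def e_def)
    have "(map_mat of_rat A *\<^sub>v x + map_mat of_rat B *\<^sub>v y
        + map_mat of_rat C *\<^sub>v map_vec of_int (vec r (\<lambda>j. w (\<sigma> j))) \<ge> map_vec of_rat e)
      \<longleftrightarrow> (\<forall>l<k. of_rat (e $ l) \<le> of_rat (e $ l) - \<rho> l x w)"
      unfolding less_eq_vec_def using row[OF x y, of _ w] dims
      by (simp del: index_add_vec(1) index_mult_mat_vec)
    also have "\<dots> \<longleftrightarrow> (\<forall>g\<in>\<rho> ` {0..<k}. g x w \<le> 0)"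
      by auto
    also have "\<rho> ` {0..<k} = R"
      using \<rho> by (simp add: bij_betw_def k_def)
    finally show ?thesis .
  qed
  have "(\<exists>w. \<forall>g\<in>R. g x w \<le> 0) \<longleftrightarrow>
      (\<exists>y\<in>carrier_vec 0. \<exists>v :: int vec \<in> carrier_vec r.
         map_mat of_rat A *\<^sub>v x + map_mat of_rat B *\<^sub>v y + map_mat of_rat C *\<^sub>v map_vec of_int v
           \<ge> map_vec of_rat e)" (is "?lhs \<longleftrightarrow> ?rhs")
    if x: "x \<in> carrier_vec N" for x
  proof
    assume ?lhs
    then obtain w where "\<forall>g\<in>R. g x w \<le> 0" ..
    then show ?rhs
      using sys[OF x zero_carrier_vec, of w] by (intro bexI[OF _ zero_carrier_vec] bexI) auto
  next
    assume ?rhs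
    then obtain y v where y: "y \<in> carrier_vec 0" and v: "v \<in> carrier_vec r"
      and le: "map_mat of_rat A *\<^sub>v x + map_mat of_rat B *\<^sub>v y
         + map_mat of_rat C *\<^sub>v map_vec of_int v \<ge> map_vec of_rat e"
      by blast
    define w where "w j = v $ the_inv_into {0..<r} \<sigma> j" for j
    have "vec r (\<lambda>j. w (\<sigma> j)) = v"
      using v \<sigma> by (intro eq_vecI) (auto simp: w_def r_def bij_betw_def the_inv_into_f_f)
    then show ?lhs
      using sys[OF x y, of w] le by auto
  qed
  then have "{x \<in> carrier_vec N. \<exists>w. \<forall>g\<in>R. g x w \<le> 0} =
      {x \<in> carrier_vec N. \<exists>y\<in>carrier_vec 0. \<exists>v :: int vec \<in> carrier_vec r.
         map_mat of_rat A *\<^sub>v x + map_mat of_rat B *\<^sub>v y + map_mat of_rat C *\<^sub>v map_vec of_int v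
           \<ge> map_vec of_rat e}"
    by blast
  then show ?thesis
    unfolding milp_representable_def
    by (intro exI[of _ k] exI[of _ 0] exI[of _ r] exI[of _ A] exI[of _ B] exI[of _ C] exI[of _ e])
      (simp add: A_def B_def C_def e_def)
qed

section \<open>Replacing ceilings by integer variables\<close>

fun ceil_args :: "chvatal_tree \<Rightarrow> chvatal_tree set" where
  "ceil_args (Leaf a c) = {}"
| "ceil_args (Ceil t) = insert t (ceil_args t)"
| "ceil_args (Scale \<alpha> t) = ceil_args t"
| "ceil_args (Comb \<alpha> t \<beta> u) = ceil_args t \<union> ceil_args u"

text \<open>A ceiling is cut off at its argument \<open>t\<close>, whose own relaxation does not enter the value here.
  The link between \<open>w t\<close> and \<open>t\<close> is the separate linear constraint \<open>relax t x w \<le> w t\<close>, one for each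
  element of \<open>ceil_args\<close>.\<close>

fun relax :: "chvatal_tree \<Rightarrow> real vec \<Rightarrow> (chvatal_tree \<Rightarrow> int) \<Rightarrow> real" where
  "relax (Leaf a c) x w = map_vec of_rat a \<bullet> x + of_rat c"
| "relax (Ceil t) x w = of_int (w t)"
| "relax (Scale \<alpha> t) x w = of_rat \<alpha> * relax t x w"
| "relax (Comb \<alpha> t \<beta> u) x w = of_rat \<alpha> * relax t x w + of_rat \<beta> * relax u x w"

lemma finite_ceil_args: "finite (ceil_args t)"
  by (induction t) auto

lemma ceil_args_trans: "u \<in> ceil_args t \<Longrightarrow> ceil_args u \<subseteq> ceil_args t"
  by (induction t) auto

lemma tree_wf_ceil_args: "tree_wf N t \<Longrightarrow> u \<in> ceil_args t \<Longrightarrow> tree_wf N u"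
  by (induction t) auto

lemma rational_affine_relax:
  assumes "tree_wf N t" "finite U" "ceil_args t \<subseteq> U"
  shows "rational_affine N U (relax t)"
  using assms
proof (induction t)
  case (Leaf a c)
  then show ?case by (simp add: rational_affine_scalar_prod)
next
  case (Ceil t)
  then show ?case by (simp add: rational_affine_integer_var)
next
  case (Scale \<alpha> t)
  then show ?case using rational_affine_comb[of N U "relax t" "relax t" \<alpha> 0] by simp
next
  case (Comb \<alpha> t \<beta> u)
  then show ?case by (simp add: rational_affine_comb)
qed

text \<open>Nonnegative labels preserve overestimates of the children, and rounding up preserves upper
  bounds that are integers.\<close>

lemma tree_fun_le_relax:
  assumes "tree_wf N t" and "\<And>u. u \<in> ceil_args t \<Longrightarrow> relax u x w \<le> of_int (w u)"
  shows "tree_fun t x \<le> relax t x w"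
  using assms
proof (induction t)
  case (Ceil t)
  then have "tree_fun t x \<le> of_int (w t)"
    by (force intro: order_trans)
  then show ?case
    by (simp add: ceiling_le_iff)
qed (auto intro!: mult_left_mono add_mono)

text \<open>Since \<open>a \<le> \<lceil>a\<rceil>\<close>, this choice of the integer variables also satisfies all the constraints
  \<open>relax u x w \<le> w u\<close>.\<close>

lemma relax_true_ceilings: "relax t x (\<lambda>u. \<lceil>tree_fun u x\<rceil>) = tree_fun t x"
  by (induction t) auto

lemma milp_representable_chvatal_system:
  assumes "finite T" and wf: "\<And>t b. (t, b) \<in> T \<Longrightarrow> tree_wf N t"
  shows "milp_representable N {x \<in> carrier_vec N. \<forall>(t, b)\<in>T. tree_fun t x \<le> of_rat b}"
proof -
  define U where "U = (\<Union>(t, b)\<in>T. ceil_args t)"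
  have finU: "finite U"
    using \<open>finite T\<close> unfolding U_def by (auto simp: finite_ceil_args)
  have sub: "ceil_args t \<subseteq> U" if "(t, b) \<in> T" for t b
    using that unfolding U_def by blast
  have U: "tree_wf N u" "ceil_args u \<subseteq> U" if "u \<in> U" for u
    using that wf tree_wf_ceil_args ceil_args_trans unfolding U_def by fast+
  \<comment> \<open>a nested ceiling argument belongs to \<open>U\<close> as well, so its constraint is included\<close>
  define R where "R = (\<lambda>(t, b) x w. relax t x w - of_rat b) ` T
    \<union> (\<lambda>u x w. relax u x w - of_int (w u)) ` U"
  have "rational_affine N U g" if "g \<in> R" for g
    using that finU wf U(1) unfolding R_def
    by (auto intro!: rational_affine_diff rational_affine_relax rational_affine_const
        rational_affine_integer_var dest: sub[THEN subsetD] U(2)[THEN subsetD])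
  then have "milp_representable N {x \<in> carrier_vec N. \<exists>w. \<forall>g\<in>R. g x w \<le> 0}"
    using finU \<open>finite T\<close> by (intro milp_representable_affine_system) (auto simp: R_def)
  moreover have "(\<exists>w. \<forall>g\<in>R. g x w \<le> 0) \<longleftrightarrow> (\<forall>(t, b)\<in>T. tree_fun t x \<le> of_rat b)"
    (is "?lhs \<longleftrightarrow> ?rhs") for x
  proof
    assume ?lhs
    then obtain w where "\<forall>g\<in>R. g x w \<le> 0" ..
    then have w: "\<And>t b. (t, b) \<in> T \<Longrightarrow> relax t x w \<le> of_rat b"
      "\<And>u. u \<in> U \<Longrightarrow> relax u x w \<le> of_int (w u)"
      unfolding R_def by (auto simp: ball_Un)
    have "tree_fun t x \<le> of_rat b" if "(t, b) \<in> T" for t b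
      using tree_fun_le_relax[OF wf[OF that], of x w] w sub[OF that] that by fastforce
    then show ?rhs by blast
  next
    assume ?rhs
    then show ?lhs
      by (intro exI[of _ "\<lambda>u. \<lceil>tree_fun u x\<rceil>"]) (auto simp: R_def relax_true_ceilings)
  qed
  ultimately show ?thesis by simp
qed

section \<open>Integrality as an affine Chvatal inequality\<close>

definition round_up_gap :: "nat \<Rightarrow> nat \<Rightarrow> chvatal_tree" where
  "round_up_gap N k = Comb 1 (Ceil (Leaf (unit_vec N k) 0)) 1 (Leaf (- unit_vec N k) 0)"

lemma tree_wf_round_up_gap: "tree_wf N (round_up_gap N k)"
  by (simp add: round_up_gap_def)

lemma tree_fun_round_up_gap_le_0_iff:
  assumes "x \<in> carrier_vec N" "k < N"
  shows "tree_fun (round_up_gap N k) x \<le> 0 \<longleftrightarrow> x $ k \<in> \<int>"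
proof -
  have unit: "map_vec of_rat (unit_vec N k) = (unit_vec N k :: real vec)"
    by (intro eq_vecI) (auto simp: unit_vec_def)
  have neg: "map_vec of_rat (- unit_vec N k) = (- unit_vec N k :: real vec)"
    using \<open>k < N\<close> by (intro eq_vecI) (auto simp: unit_vec_def of_rat_minus)
  have "tree_fun (round_up_gap N k) x = of_int \<lceil>x $ k\<rceil> - x $ k"
    using assms by (simp add: round_up_gap_def unit neg)
  moreover have "of_int \<lceil>x $ k\<rceil> - x $ k \<le> 0 \<longleftrightarrow> x $ k \<in> \<int>"
    by (metis Ints_of_int antisym ceiling_of_int Ints_cases diff_le_0_iff_le le_of_int_ceiling
        order_refl)
  ultimately show ?thesis by simp
qed

theorem theorem4p3:
  fixes n q m :: nat
    and f :: "nat \<Rightarrow> real vec \<Rightarrow> real"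
    and b :: "nat \<Rightarrow> real"
  assumes "\<And>i. i < m \<Longrightarrow> affine_chvatal (n + q) (f i)"
    and "\<And>i. i < m \<Longrightarrow> b i \<in> \<rat>"
  shows "milp_representable (n + q) (mic_set n q m f b)"
proof -
  define N where "N = n + q"
  have "\<forall>i. \<exists>t. i < m \<longrightarrow> tree_wf N t \<and> (\<forall>x\<in>carrier_vec N. f i x = tree_fun t x)"
    using assms(1) unfolding affine_chvatal_def N_def by blast
  then obtain t where wf: "\<And>i. i < m \<Longrightarrow> tree_wf N (t i)"
    and ft: "\<And>i x. i < m \<Longrightarrow> x \<in> carrier_vec N \<Longrightarrow> f i x = tree_fun (t i) x"
    by metis
  have "\<forall>i. \<exists>c. i < m \<longrightarrow> b i = of_rat c"
    using assms(2) by (metis Rats_cases)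
  then obtain c where bc: "\<And>i. i < m \<Longrightarrow> b i = of_rat (c i)"
    by metis
  define T where "T = (\<lambda>i. (t i, c i)) ` {..<m} \<union> (\<lambda>k. (round_up_gap N k, 0)) ` {n..<N}"
  have T: "(\<forall>(t, b)\<in>T. tree_fun t x \<le> of_rat b)
      \<longleftrightarrow> (\<forall>i<m. f i x \<le> b i) \<and> (\<forall>k\<in>{n..<N}. x $ k \<in> \<int>)"
    if "x \<in> carrier_vec N" for x
    using that by (auto simp: T_def ft bc tree_fun_round_up_gap_le_0_iff ball_Un)
  have "mic_set n q m f b = {x \<in> carrier_vec N. \<forall>(t, b)\<in>T. tree_fun t x \<le> of_rat b}"
    (is "_ = ?S")
  proof
    show "mic_set n q m f b \<subseteq> ?S"
    proof
      fix v
      assume "v \<in> mic_set n q m f b"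
      then obtain x z where v: "v = x @\<^sub>v map_vec of_int z" and x: "x \<in> carrier_vec n"
        and z: "z \<in> carrier_vec q" and le: "\<forall>i<m. f i v \<le> b i"
        unfolding mic_set_def by blast
      have "v \<in> carrier_vec N"
        using v x z by (simp add: N_def)
      moreover have "\<forall>k\<in>{n..<N}. v $ k \<in> \<int>"
        using v x z by (auto simp: N_def)
      ultimately show "v \<in> ?S"
        using le T by blast
    qed
  next
    show "?S \<subseteq> mic_set n q m f b"
    proof
      fix v
      assume v: "v \<in> ?S"
      then have vN: "v \<in> carrier_vec N" and le: "\<forall>i<m. f i v \<le> b i"
        and int: "\<forall>k\<in>{n..<N}. v $ k \<in> \<int>"
        using T by blast+
      define x where "x = vec n (\<lambda>i. v $ i)"
      define z where "z = vec q (\<lambda>k. \<lfloor>v $ (n + k)\<rfloor>)"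
      have "v = x @\<^sub>v map_vec of_int z"
      proof (rule eq_vecI)
        fix i
        assume "i < dim_vec (x @\<^sub>v map_vec of_int z)"
        then have "i < N"
          by (simp add: x_def z_def N_def)
        then show "v $ i = (x @\<^sub>v map_vec of_int z) $ i"
          using int by (auto simp: x_def z_def N_def)
      qed (use vN in \<open>simp add: x_def z_def N_def\<close>)
      moreover have "x \<in> carrier_vec n" "z \<in> carrier_vec q"
        by (simp_all add: x_def z_def)
      ultimately show "v \<in> mic_set n q m f b"
        using le unfolding mic_set_def by blast
    qed
  qed
  moreover have "milp_representable N ?S"
    using wf by (intro milp_representable_chvatal_system)
      (auto simp: T_def tree_wf_round_up_gap)
  ultimately show ?thesis
    by (simp add: N_def)
qed

end
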